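(* Let $E$ be a nonzero real Banach space and let $S : E \rightrightarrows E^*$ be maximally monotone. Then $S$ is quasidense if and only if $$\theta_S(y^*,y^{**}) \ge \langle y^*, y^{**}\rangle \quad \text{for all } (y^*,y^{**}) \in E^* \times E^{**}.$$
   Context: For a multifunction $S : E \rightrightarrows E^*$, $G(S) := \{(x,x^* ) : x^* \in Sx\}$ is its graph; $S$ is maximally monotone if $G(S)$ is a maximally monotone subset of $E \times E^*$. $S$ is quasidense if, for all $(x,x^* ) \in E \times E^*$, $\inf_{(s,s^* ) \in G(S)}\big[\frac12\|s-x\|^2 + \frac12\|s^*-x^*\|^2 + \langle s-x, s^*-x^*\rangle\big] \le 0$. The function $\theta_S : E^* \times E^{**} \to\, ]-\infty,\infty]$ is $\theta_S(y^*,y^{**}) := \sup_{(s,s^* ) \in G(S)}[\langle s, y^*\rangle + \langle s^*, y^{**}\rangle - \langle s, s^*\rangle]$. *)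

theory Defs
  imports "HOL-Analysis.Analysis"
begin

text \<open>
  The dual of a real normed space \<open>'a\<close> is \<open>'a \<Rightarrow>\<^sub>L real\<close> with its operator norm, and the
  bidual is \<open>('a \<Rightarrow>\<^sub>L real) \<Rightarrow>\<^sub>L real\<close>. The pairing \<open>\<langle>x, x\<^sup>*\<rangle>\<close> is \<open>blinfun_apply x\<^sup>* x\<close>.
  A multifunction is a set-valued map.
\<close>

type_synonym 'a dual = "'a \<Rightarrow>\<^sub>L real"

type_synonym 'a bidual = "('a \<Rightarrow>\<^sub>L real) \<Rightarrow>\<^sub>L real"

definition graph :: "('a::real_normed_vector \<Rightarrow> 'a dual set) \<Rightarrow> ('a \<times> 'a dual) set"
  where "graph S = {(x, x'). x' \<in> S x}"

definition monotone_set :: "('a::real_normed_vector \<times> 'a dual) set \<Rightarrow> bool"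
  where "monotone_set A \<longleftrightarrow>
    (\<forall>(s, s') \<in> A. \<forall>(t, t') \<in> A. 0 \<le> blinfun_apply (s' - t') (s - t))"

definition maximally_monotone_set :: "('a::real_normed_vector \<times> 'a dual) set \<Rightarrow> bool"
  where "maximally_monotone_set A \<longleftrightarrow>
    monotone_set A \<and> (\<forall>B. monotone_set B \<and> A \<subseteq> B \<longrightarrow> B = A)"

definition maximally_monotone :: "('a::real_normed_vector \<Rightarrow> 'a dual set) \<Rightarrow> bool"
  where "maximally_monotone S \<longleftrightarrow> maximally_monotone_set (graph S)"

text \<open>
  The infimum and the supremum below are taken in the extended reals, so that the
  infimum over an empty graph is \<open>\<infinity>\<close> and the supremum may take the value \<open>\<infinity>\<close>.
\<close>

definition quasidense :: "('a::real_normed_vector \<Rightarrow> 'a dual set) \<Rightarrow> bool"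
  where "quasidense S \<longleftrightarrow>
    (\<forall>x x'. (INF (s, s') \<in> graph S.
       ereal ((norm (s - x))\<^sup>2 / 2 + (norm (s' - x'))\<^sup>2 / 2
              + blinfun_apply (s' - x') (s - x))) \<le> 0)"

definition theta :: "('a::real_normed_vector \<Rightarrow> 'a dual set) \<Rightarrow> 'a dual \<Rightarrow> 'a bidual \<Rightarrow> ereal"
  where "theta S y' y'' =
    (SUP (s, s') \<in> graph S.
       ereal (blinfun_apply y' s + blinfun_apply y'' s' - blinfun_apply s' s))"

end

theory Submission
  imports Defs
begin

text \<open>
  On \<open>B = E \<times> E\<^sup>*\<close> put \<open>q(x, x\<^sup>*) = \<langle>x, x\<^sup>*\<rangle>\<close> (\<open>coupling\<close>) and \<open>r(b) = \<parallel>b\<parallel>\<^sup>2/2 + q(b) \<ge> 0\<close>, and let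
  \<open>G\<close> be the graph of \<open>S\<close>. Quasidensity says that for every \<open>c \<in> B\<close> the infimum of \<open>r(g - c)\<close> over
  \<open>g \<in> G\<close> is \<open>\<le> 0\<close>. The inequality for \<open>\<theta>\<^sub>S\<close> says that for every \<open>(y\<^sup>*, y\<^sup>*\<^sup>*)\<close> the infimum of
  \<open>\<langle>s\<^sup>* - y\<^sup>*, s - y\<^sup>*\<^sup>*\<rangle>\<close> over \<open>(s, s\<^sup>*) \<in> G\<close> is \<open>\<le> 0\<close>. These are the same kind of condition, with
  \<open>E\<close> in one place and \<open>E\<^sup>*\<^sup>*\<close> in the other.

  From quasidensity to the inequality (\<open>bidual_inequality_of_dense\<close>): choose \<open>u\<^sup>* \<in> E\<^sup>*\<close> of norm at
  most \<open>R = \<parallel>y\<^sup>*\<^sup>*\<parallel>\<close> with \<open>\<langle>u\<^sup>*, y\<^sup>*\<^sup>*\<rangle>\<close> almost \<open>R\<^sup>2\<close>, and test quasidensity at \<open>c = (0, y\<^sup>* + u\<^sup>*)\<close>. The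
  element of \<open>G\<close> so obtained also works for \<open>(y\<^sup>*, y\<^sup>*\<^sup>*)\<close>, because the error terms combine to
  \<open>-(\<parallel>s\<parallel> - R)\<^sup>2/2 - (\<parallel>s\<^sup>* - y\<^sup>* - u\<^sup>*\<parallel> - R)\<^sup>2/2\<close>.

  Conversely, the inequality for \<open>\<theta>\<^sub>S\<close> bounds a conjugate function from below, and convex duality
  turns this into a statement about \<open>B\<close> itself. The duality is a sandwich theorem (\<open>affine_sandwich\<close>),
  which rests on a form of the Hahn-Banach theorem (\<open>convex_linear_minorant\<close>). It is applied to
  \<open>\<parallel>\<cdot>\<parallel>\<^sup>2/2\<close> and the convex hull of the points \<open>(s - c, q(s - c))\<close>, \<open>s \<in> G\<close>. The result
  (\<open>approximable_of_bidual_inequality\<close>) is not yet an element of \<open>G\<close> near \<open>c\<close>, but an almost member: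
  a point \<open>b\<close> with \<open>r(b - c) \<le> \<epsilon>\<close> and \<open>q(b - t) \<ge> -\<epsilon>\<close> for all \<open>t \<in> G\<close>. It remains to move \<open>b\<close> into \<open>G\<close>
  by a small amount. Maximality of \<open>G\<close> forces \<open>q(b - b') \<ge> -2(e + e')\<close> for two almost members with errors
  \<open>e\<close> and \<open>e'\<close> (\<open>almost_members_coupling\<close>). If \<open>b'\<close> is obtained from \<open>b\<close> in the same way as \<open>b\<close> from
  \<open>c\<close>, so that \<open>r(b' - b)\<close> is small, this makes \<open>\<parallel>b' - b\<parallel>\<close> small. Iterating with errors that decrease
  geometrically gives a Cauchy sequence, and its limit is monotonically related to \<open>G\<close>, so it belongs
  to \<open>G\<close> (\<open>almost_member_near_member\<close>).
\<close>

section \<open>Linear minorants of convex functions\<close>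

text \<open>
  The convexity inequality may use three different members of the family, which covers infima over
  chains of convex functions as well as infima of jointly convex functions in one of their variables.
\<close>

lemma convex_on_INF_directed:
  fixes \<phi> :: "'i \<Rightarrow> 'v::real_vector \<Rightarrow> real"
  assumes "I \<noteq> {}" and bdd: "\<And>x. bdd_below ((\<lambda>i. \<phi> i x) ` I)"
    and dir: "\<And>i j x y u v. i \<in> I \<Longrightarrow> j \<in> I \<Longrightarrow> 0 \<le> u \<Longrightarrow> 0 \<le> v \<Longrightarrow> u + v = 1 \<Longrightarrow>
      \<exists>k\<in>I. \<phi> k (u *\<^sub>R x + v *\<^sub>R y) \<le> u * \<phi> i x + v * \<phi> j y"
  shows "convex_on UNIV (\<lambda>x. INF i\<in>I. \<phi> i x)"
  unfolding convex_on_def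
proof (intro conjI ballI allI impI convex_UNIV)
  fix x y :: 'v and u v :: real
  assume uv: "0 \<le> u" "0 \<le> v" "u + v = 1"
  let ?h = "\<lambda>x. INF i\<in>I. \<phi> i x"
  show "?h (u *\<^sub>R x + v *\<^sub>R y) \<le> u * ?h x + v * ?h y"
  proof (rule field_le_epsilon)
    fix e :: real assume e: "0 < e"
    obtain i where i: "i \<in> I" "\<phi> i x < ?h x + e"
      using cINF_less_iff[OF \<open>I \<noteq> {}\<close> bdd, of x "?h x + e"] e by auto
    obtain j where j: "j \<in> I" "\<phi> j y < ?h y + e"
      using cINF_less_iff[OF \<open>I \<noteq> {}\<close> bdd, of y "?h y + e"] e by auto
    obtain k where k: "k \<in> I" "\<phi> k (u *\<^sub>R x + v *\<^sub>R y) \<le> u * \<phi> i x + v * \<phi> j y"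
      using dir[OF i(1) j(1) uv] by blast
    have "?h (u *\<^sub>R x + v *\<^sub>R y) \<le> u * \<phi> i x + v * \<phi> j y"
      using cINF_lower[OF bdd k(1)] k(2) by (rule order_trans)
    also have "\<dots> \<le> u * (?h x + e) + v * (?h y + e)"
      using i(2) j(2) uv by (intro add_mono mult_left_mono) auto
    also have "\<dots> = u * ?h x + v * ?h y + (u + v) * e"
      by (simp add: algebra_simps)
    finally show "?h (u *\<^sub>R x + v *\<^sub>R y) \<le> u * ?h x + v * ?h y + e"
      using uv by simp
  qed
qed

lemma convex_on_midpoint:
  assumes "convex_on UNIV h"
  shows "h ((1/2) *\<^sub>R x + (1/2) *\<^sub>R y) \<le> h x / 2 + h y / 2"
proof -
  have "h ((1/2) *\<^sub>R x + (1/2) *\<^sub>R y) \<le> (1/2) * h x + (1/2) * h y"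
    using convex_onD[OF assms, of "1/2" x y] by simp
  then show ?thesis by simp
qed

text \<open>
  Convexity and \<open>h 0 \<ge> 0\<close> make every quotient \<open>h t / t\<close> with \<open>t < 0\<close> at most every such quotient with
  \<open>t > 0\<close>, so the infimum of the latter is a suitable slope.
\<close>

lemma real_convex_linear_minorant:
  fixes h :: "real \<Rightarrow> real"
  assumes h: "convex_on UNIV h" and "0 \<le> h 0"
  obtains a where "\<And>t. t * a \<le> h t"
proof -
  have slope: "- h (- s) / s \<le> h t / t" if "0 < s" "0 < t" for s t
  proof -
    have conv: "h (\<alpha> * (- s) + \<beta> * t) \<le> \<alpha> * h (- s) + \<beta> * h t"
      if "0 \<le> \<alpha>" "0 \<le> \<beta>" "\<alpha> + \<beta> = 1" for \<alpha> \<beta>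
      using h that unfolding convex_on_def real_scaleR_def by blast
    have "h (t / (s + t) * (- s) + s / (s + t) * t) \<le> t / (s + t) * h (- s) + s / (s + t) * h t"
    proof (rule conv)
      show "t / (s + t) + s / (s + t) = 1"
        using that add_divide_distrib[of t s "s + t"] by (simp add: add.commute)
    qed (use that in simp_all)
    moreover have "t / (s + t) * (- s) + s / (s + t) * t = 0"
      by (simp add: field_simps)
    ultimately have "0 \<le> (t * h (- s) + s * h t) / (s + t)"
      using \<open>0 \<le> h 0\<close> by (simp add: add_divide_distrib)
    then have "0 \<le> t * h (- s) + s * h t"
      using that by (simp add: zero_le_divide_iff)
    then show ?thesis
      using that by (simp add: field_simps)
  qed
  define a where "a = (INF t\<in>{0<..}. h t / t)"
  have bdd: "bdd_below ((\<lambda>t. h t / t) ` {0<..})"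
    using slope[of 1] by (intro bdd_belowI2) auto
  have "t * a \<le> h t" for t
  proof (cases t "0::real" rule: linorder_cases)
    case less
    have "- h (- (- t)) / (- t) \<le> a"
      unfolding a_def by (intro cINF_greatest) (use less slope[of "- t"] in auto)
    then show ?thesis using less by (simp add: field_simps)
  next
    case equal
    then show ?thesis using \<open>0 \<le> h 0\<close> by simp
  next
    case greater
    then have "a \<le> h t / t"
      unfolding a_def by (intro cINF_lower bdd) auto
    then show ?thesis using greater by (simp add: field_simps)
  qed
  then show ?thesis by (rule that)
qed

lemma convex_on_ge_reflection:
  fixes h :: "'v::real_vector \<Rightarrow> real"
  assumes "convex_on UNIV h" "0 \<le> h 0"
  shows "- h (- v) \<le> h v"
  using convex_on_midpoint[OF assms(1), of v "- v"] assms(2) by simp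

text \<open>
  Let \<open>a\<close> be a slope below \<open>h\<close> on the line spanned by \<open>u\<close>. Replacing \<open>h\<close> by the infimum over \<open>t\<close> of
  \<open>h (v + t u) - t a\<close> keeps it convex, nonnegative at the origin and below \<open>h\<close>, so by minimality nothing
  changes: \<open>h v \<le> h (v + t u) - t a\<close>. Using this for \<open>t\<close> and \<open>-t\<close> gives equality.
\<close>

lemma minimal_convex_translation:
  fixes h :: "'v::real_vector \<Rightarrow> real"
  assumes h: "convex_on UNIV h" "0 \<le> h 0"
    and min: "\<And>g. convex_on UNIV g \<Longrightarrow> 0 \<le> g 0 \<Longrightarrow> (\<And>v. g v \<le> h v) \<Longrightarrow> g = h"
  obtains a where "\<And>v t. h (v + t *\<^sub>R u) = h v + t * a"
proof -
  have "convex_on UNIV (\<lambda>t. h (t *\<^sub>R u))"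
    unfolding convex_on_def
  proof (intro conjI ballI allI impI convex_UNIV)
    fix x y \<alpha> \<beta> :: real
    assume "0 \<le> \<alpha>" "0 \<le> \<beta>" "\<alpha> + \<beta> = 1"
    then have "h (\<alpha> *\<^sub>R x *\<^sub>R u + \<beta> *\<^sub>R y *\<^sub>R u) \<le> \<alpha> * h (x *\<^sub>R u) + \<beta> * h (y *\<^sub>R u)"
      using h(1) unfolding convex_on_def by blast
    then show "h ((\<alpha> *\<^sub>R x + \<beta> *\<^sub>R y) *\<^sub>R u) \<le> \<alpha> * h (x *\<^sub>R u) + \<beta> * h (y *\<^sub>R u)"
      by (simp add: scaleR_add_left)
  qed
  then obtain a where a: "\<And>t. t * a \<le> h (t *\<^sub>R u)"
    using real_convex_linear_minorant[of "\<lambda>t. h (t *\<^sub>R u)"] h(2) by auto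
  define \<phi> where "\<phi> t v = h (v + t *\<^sub>R u) - t * a" for t v
  define g where "g v = (INF t. \<phi> t v)" for v
  have lower: "- h (- v) \<le> \<phi> t v" for t v
  proof -
    have "(t / 2) * a \<le> h ((t / 2) *\<^sub>R u)" by (rule a)
    also have "(t / 2) *\<^sub>R u = (1/2) *\<^sub>R (v + t *\<^sub>R u) + (1/2) *\<^sub>R (- v)"
      by (simp add: scaleR_add_right)
    also have "h \<dots> \<le> h (v + t *\<^sub>R u) / 2 + h (- v) / 2"
      by (rule convex_on_midpoint[OF h(1)])
    finally show ?thesis by (simp add: \<phi>_def)
  qed
  have bdd: "bdd_below (range (\<lambda>t. \<phi> t v))" for v
    using lower by (intro bdd_belowI2)
  have "g = h"
  proof (rule min)
    show "convex_on UNIV g"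
      unfolding g_def
    proof (rule convex_on_INF_directed[OF _ bdd])
      fix i j \<alpha> \<beta> :: real and x y :: 'v
      assume "0 \<le> \<alpha>" "0 \<le> \<beta>" "\<alpha> + \<beta> = 1"
      then have "h (\<alpha> *\<^sub>R (x + i *\<^sub>R u) + \<beta> *\<^sub>R (y + j *\<^sub>R u))
          \<le> \<alpha> * h (x + i *\<^sub>R u) + \<beta> * h (y + j *\<^sub>R u)"
        using h(1) unfolding convex_on_def by blast
      then have "\<phi> (\<alpha> * i + \<beta> * j) (\<alpha> *\<^sub>R x + \<beta> *\<^sub>R y) \<le> \<alpha> * \<phi> i x + \<beta> * \<phi> j y"
        by (simp add: \<phi>_def algebra_simps)
      then show "\<exists>k\<in>UNIV. \<phi> k (\<alpha> *\<^sub>R x + \<beta> *\<^sub>R y) \<le> \<alpha> * \<phi> i x + \<beta> * \<phi> j y"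
        by blast
    qed simp
    show "0 \<le> g 0"
      unfolding g_def by (intro cINF_greatest) (use a in \<open>auto simp: \<phi>_def\<close>)
    show "g v \<le> h v" for v
      using cINF_lower[OF bdd, of 0 v] by (simp add: g_def \<phi>_def)
  qed
  then have le: "h v \<le> h (v + t *\<^sub>R u) - t * a" for v t
    using cINF_lower[OF bdd, of t v] by (auto simp: g_def \<phi>_def fun_eq_iff)
  have "h (v + t *\<^sub>R u) = h v + t * a" for v t
    using le[of v t] le[of "v + t *\<^sub>R u" "- t"] by simp
  then show ?thesis by (rule that)
qed

text \<open>
  The Hahn-Banach theorem with a convex instead of a sublinear bound. By Zorn's lemma there is a
  minimal convex function below \<open>h\<close> that is nonnegative at the origin; chains are bounded below
  because each \<open>f\<close> in them satisfies \<open>f v \<ge> - h (- v)\<close>. A minimal function is affine along every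
  direction by the preceding lemma, hence linear.
\<close>

lemma convex_linear_minorant:
  fixes h :: "'v::real_vector \<Rightarrow> real"
  assumes h: "convex_on UNIV h" "0 \<le> h 0"
  obtains L where "linear L" "\<And>v. L v \<le> h v"
proof -
  define A where "A = {f. convex_on UNIV f \<and> 0 \<le> f 0 \<and> (\<forall>v. f v \<le> h v)}"
  define P where "P f g \<longleftrightarrow> g \<le> f" for f g :: "'v \<Rightarrow> real"
  have "\<exists>m\<in>A. \<forall>a\<in>A. P m a \<longrightarrow> a = m"
  proof (rule predicate_Zorn)
    show "partial_order_on A (relation_of P A)"
      by (rule partial_order_on_relation_ofI) (auto simp: P_def)
  next
    fix C assume C: "C \<in> Chains (relation_of P A)"
    then have CA: "C \<subseteq> A" and total: "\<And>f g. f \<in> C \<Longrightarrow> g \<in> C \<Longrightarrow> f \<le> g \<or> g \<le> f"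
      unfolding Chains_def relation_of_def P_def by auto
    show "\<exists>u\<in>A. \<forall>a\<in>C. P a u"
    proof (cases "C = {}")
      case True
      then show ?thesis using h by (auto simp: A_def)
    next
      case False
      define g where "g v = (INF f\<in>C. f v)" for v
      have lower: "- h (- v) \<le> f v" if "f \<in> C" for f v
      proof -
        have f: "convex_on UNIV f" "0 \<le> f 0" "f (- v) \<le> h (- v)"
          using that CA by (auto simp: A_def)
        show ?thesis
          using convex_on_ge_reflection[OF f(1,2), of v] f(3) by linarith
      qed
      have bdd: "bdd_below ((\<lambda>f. f v) ` C)" for v
        using lower by (intro bdd_belowI2)
      have "convex_on UNIV g"
        unfolding g_def
      proof (rule convex_on_INF_directed[OF False bdd])
        fix f1 f2 :: "'v \<Rightarrow> real" and x y :: 'v and u v :: real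
        assume f: "f1 \<in> C" "f2 \<in> C" and uv: "0 \<le> u" "0 \<le> v" "u + v = 1"
        obtain f where "f \<in> C" "f \<le> f1" "f \<le> f2"
          using total[OF f] f by auto
        moreover have "f (u *\<^sub>R x + v *\<^sub>R y) \<le> u * f x + v * f y"
          using \<open>f \<in> C\<close> CA uv unfolding A_def convex_on_def by blast
        moreover have "u * f x + v * f y \<le> u * f1 x + v * f2 y"
          using \<open>f \<le> f1\<close> \<open>f \<le> f2\<close> uv by (intro add_mono mult_left_mono) (auto simp: le_fun_def)
        ultimately show "\<exists>k\<in>C. k (u *\<^sub>R x + v *\<^sub>R y) \<le> u * f1 x + v * f2 y"
          by (intro bexI[of _ f]) auto
      qed
      moreover have "0 \<le> g 0"
        unfolding g_def using CA by (intro cINF_greatest False) (auto simp: A_def)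
      moreover have le: "g v \<le> f v" if "f \<in> C" for f v
        unfolding g_def using cINF_lower[OF bdd that] .
      moreover have "g v \<le> h v" for v
      proof -
        obtain f where "f \<in> C" using False by blast
        then have "g v \<le> f v" "f v \<le> h v"
          using le CA by (auto simp: A_def)
        then show ?thesis by (rule order_trans)
      qed
      ultimately show ?thesis
        by (intro bexI[of _ g]) (auto simp: A_def P_def le_fun_def)
    qed
  qed
  then obtain m where m: "convex_on UNIV m" "0 \<le> m 0" "\<And>v. m v \<le> h v"
    and min: "\<And>g. g \<in> A \<Longrightarrow> g \<le> m \<Longrightarrow> g = m"
    unfolding A_def P_def by blast
  have min': "g = m" if "convex_on UNIV g" "0 \<le> g 0" "\<And>v. g v \<le> m v" for g
    using that m(3) by (intro min) (auto simp: A_def le_fun_def intro: order_trans)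
  \<comment> \<open>Subtracting the constant \<open>m 0 \<ge> 0\<close> stays in the class, so minimality forces \<open>m 0 = 0\<close>.\<close>
  have "(\<lambda>v. m v - m 0) = m"
  proof (rule min')
    show "convex_on UNIV (\<lambda>v. m v - m 0)"
      unfolding convex_on_def
    proof (intro conjI ballI allI impI convex_UNIV)
      fix x y :: 'v and u v :: real
      assume uv: "0 \<le> u" "0 \<le> v" "u + v = 1"
      then have "m (u *\<^sub>R x + v *\<^sub>R y) \<le> u * m x + v * m y"
        using m(1) unfolding convex_on_def by blast
      moreover have "u * m 0 + v * m 0 = m 0"
        using uv by (simp flip: distrib_right)
      ultimately show "m (u *\<^sub>R x + v *\<^sub>R y) - m 0 \<le> u * (m x - m 0) + v * (m y - m 0)"
        by (simp add: algebra_simps)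
    qed
  qed (use m(2) in auto)
  then have m0: "m 0 = 0" by (metis diff_self)
  have "linear m"
  proof (rule linearI)
    fix u v :: 'v and t :: real
    obtain a where a: "\<And>v t. m (v + t *\<^sub>R u) = m v + t * a"
      using minimal_convex_translation[OF m(1,2) min'] by blast
    have mu: "m u = a" and mt: "m (t *\<^sub>R u) = t * a"
      using a[of 0 1] a[of 0 t] m0 by auto
    show "m (t *\<^sub>R u) = t *\<^sub>R m u"
      using mu mt by simp
    show "m (u + v) = m u + m v"
      using a[of v 1] mu by (simp add: add.commute)
  qed
  then show ?thesis using that m(3) by blast
qed

text \<open>
  The set \<open>K\<close> stands for the epigraph of a convex function \<open>k\<close>. If \<open>g + k \<ge> 0\<close>, then a linear \<open>L\<close>
  separates: \<open>sup (L - g) \<le> inf (L + k)\<close>. It is a linear minorant of the convex function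
  \<open>v \<mapsto> inf {g (v + b) + \<rho> | (b, \<rho>) \<in> K}\<close>.
\<close>

lemma affine_sandwich:
  fixes g :: "'v::real_vector \<Rightarrow> real" and K :: "('v \<times> real) set"
  assumes g: "convex_on UNIV g" and K: "convex K" "K \<noteq> {}"
    and nonneg: "\<And>b \<rho>. (b, \<rho>) \<in> K \<Longrightarrow> 0 \<le> g b + \<rho>"
  obtains L where "linear L" "\<And>w b \<rho>. (b, \<rho>) \<in> K \<Longrightarrow> L w - g w \<le> L b + \<rho>"
proof -
  define \<phi> where "\<phi> p v = g (v + fst p) + snd p" for p :: "'v \<times> real" and v
  define h where "h v = (INF p\<in>K. \<phi> p v)" for v
  have dir: "\<phi> (\<alpha> *\<^sub>R p + \<beta> *\<^sub>R q) (\<alpha> *\<^sub>R x + \<beta> *\<^sub>R y) \<le> \<alpha> * \<phi> p x + \<beta> * \<phi> q y"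
    if "0 \<le> \<alpha>" "0 \<le> \<beta>" "\<alpha> + \<beta> = 1" for p q \<alpha> \<beta> x y
  proof -
    have "g (\<alpha> *\<^sub>R (x + fst p) + \<beta> *\<^sub>R (y + fst q)) \<le> \<alpha> * g (x + fst p) + \<beta> * g (y + fst q)"
      using g that unfolding convex_on_def by blast
    then show ?thesis by (simp add: \<phi>_def algebra_simps)
  qed
  have \<phi>0: "0 \<le> \<phi> p 0" if "p \<in> K" for p
    using nonneg[of "fst p" "snd p"] that by (simp add: \<phi>_def)
  obtain p0 where p0: "p0 \<in> K" using K(2) by blast
  have lower: "- \<phi> p0 (- v) \<le> \<phi> p v" if "p \<in> K" for p v
  proof -
    have "(1/2) *\<^sub>R p + (1/2) *\<^sub>R p0 \<in> K"
      using K(1) that p0 by (simp add: convex_def)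
    from \<phi>0[OF this] show ?thesis
      using dir[of "1/2" "1/2" p p0 v "- v"] by simp
  qed
  have bdd: "bdd_below ((\<lambda>p. \<phi> p v) ` K)" for v
    using lower by (intro bdd_belowI2)
  have "convex_on UNIV h"
    unfolding h_def
  proof (rule convex_on_INF_directed[OF K(2) bdd])
    fix p q :: "'v \<times> real" and x y \<alpha> \<beta>
    assume pq: "p \<in> K" "q \<in> K" and \<alpha>\<beta>: "0 \<le> \<alpha>" "0 \<le> \<beta>" "\<alpha> + \<beta> = (1::real)"
    show "\<exists>k\<in>K. \<phi> k (\<alpha> *\<^sub>R x + \<beta> *\<^sub>R y) \<le> \<alpha> * \<phi> p x + \<beta> * \<phi> q y"
      using convexD[OF K(1) pq \<alpha>\<beta>] dir[OF \<alpha>\<beta>] by blast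
  qed
  moreover have "0 \<le> h 0"
    unfolding h_def by (intro cINF_greatest K(2) \<phi>0)
  ultimately obtain L where L: "linear L" "\<And>v. L v \<le> h v"
    using convex_linear_minorant by blast
  have "L w - g w \<le> L b + \<rho>" if "(b, \<rho>) \<in> K" for w b \<rho>
  proof -
    have "L w - L b = L (w - b)"
      using L(1) by (simp add: linear_diff)
    also have "\<dots> \<le> h (w - b)" by (rule L(2))
    also have "\<dots> \<le> \<phi> (b, \<rho>) (w - b)"
      unfolding h_def by (rule cINF_lower[OF bdd that])
    finally show ?thesis by (simp add: \<phi>_def)
  qed
  then show ?thesis using that L(1) by blast
qed

section \<open>The coupling\<close>

text \<open>
  The same choice serves both directions: in the bidual for the functional \<open>y\<^sup>*\<^sup>*\<close>, and in the dual
  to evaluate the conjugate of \<open>\<parallel>\<cdot>\<parallel>\<^sup>2/2\<close> up to \<open>\<delta>\<close>.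
\<close>

lemma blinfun_almost_norming:
  fixes f :: "'v::real_normed_vector \<Rightarrow>\<^sub>L real"
  assumes "0 < \<delta>"
  obtains u where "norm u \<le> norm f" "(norm f)\<^sup>2 - \<delta> \<le> blinfun_apply f u"
proof (rule ccontr)
  assume "\<not> thesis"
  then have less: "blinfun_apply f u < (norm f)\<^sup>2 - \<delta>" if "norm u \<le> norm f" for u
    using that \<open>\<And>u. norm u \<le> norm f \<Longrightarrow> (norm f)\<^sup>2 - \<delta> \<le> blinfun_apply f u \<Longrightarrow> thesis\<close>
    by fastforce
  define N where "N = norm f"
  have pos: "0 < N\<^sup>2 - \<delta>"
    using less[of 0] by (simp add: N_def)
  have "N \<noteq> 0" using pos assms by auto
  then have N: "0 < N" by (simp add: N_def)
  have half: "blinfun_apply f x \<le> (N\<^sup>2 - \<delta>) / N * norm x" for x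
  proof (cases "x = 0")
    case False
    have "blinfun_apply f ((N / norm x) *\<^sub>R x) < N\<^sup>2 - \<delta>"
      using less[of "(N / norm x) *\<^sub>R x"] False N by (simp add: N_def)
    then show ?thesis
      using False N by (simp add: blinfun.scaleR_right field_simps)
  qed simp
  have "norm (blinfun_apply f x) \<le> (N\<^sup>2 - \<delta>) / N * norm x" for x
    using half[of x] half[of "- x"] by (simp add: blinfun.minus_right abs_le_iff)
  then have "N \<le> (N\<^sup>2 - \<delta>) / N"
    unfolding N_def by (intro norm_blinfun_bound) (use N pos in \<open>auto simp: N_def\<close>)
  then show False
    using N assms by (simp add: field_simps power2_eq_square)
qed

definition coupling :: "'a::real_normed_vector \<times> 'a dual \<Rightarrow> real"
  where "coupling b = blinfun_apply (snd b) (fst b)"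

definition pairing :: "'a::real_normed_vector \<times> 'a dual \<Rightarrow> 'a \<times> 'a dual \<Rightarrow> real"
  where "pairing b c = blinfun_apply (snd c) (fst b) + blinfun_apply (snd b) (fst c)"

lemma coupling_Pair [simp]: "coupling (x, x') = blinfun_apply x' x"
  by (simp add: coupling_def)

lemma coupling_add: "coupling (b + c) = coupling b + coupling c + pairing b c"
  by (simp add: coupling_def pairing_def blinfun.bilinear_simps)

lemma coupling_minus [simp]: "coupling (- b) = coupling b"
  by (simp add: coupling_def blinfun.bilinear_simps)

lemma coupling_diff_commute: "coupling (b - c) = coupling (c - b)"
  using coupling_minus[of "b - c"] by simp

lemma norm_prod_power2: "(norm b)\<^sup>2 = (norm (fst b))\<^sup>2 + (norm (snd b))\<^sup>2"
  by (cases b) (simp add: norm_Pair)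

lemma abs_coupling_le: "\<bar>coupling b\<bar> \<le> (norm b)\<^sup>2 / 2"
proof -
  have "\<bar>coupling b\<bar> \<le> norm (snd b) * norm (fst b)"
    using norm_blinfun[of "snd b" "fst b"] by (simp add: coupling_def)
  also have "\<dots> \<le> (norm b)\<^sup>2 / 2"
    using sum_squares_bound[of "norm (snd b)" "norm (fst b)"] by (simp add: norm_prod_power2)
  finally show ?thesis .
qed

text \<open>
  The factor \<open>2\<close> is not optimal (the constant \<open>1\<close> holds by the Cauchy-Schwarz inequality), but any
  constant will do.
\<close>

lemma pairing_le: "\<bar>pairing b c\<bar> \<le> 2 * norm b * norm c"
proof -
  have "\<bar>blinfun_apply (snd c) (fst b)\<bar> \<le> norm b * norm c"
    using norm_blinfun[of "snd c" "fst b"]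
      mult_mono[OF norm_snd_le[of "snd c" "fst c"] norm_fst_le[of "fst b" "snd b"]]
    by (simp add: mult.commute)
  moreover have "\<bar>blinfun_apply (snd b) (fst c)\<bar> \<le> norm b * norm c"
    using norm_blinfun[of "snd b" "fst c"]
      mult_mono[OF norm_snd_le[of "snd b" "fst b"] norm_fst_le[of "fst c" "snd c"]] by simp
  ultimately show ?thesis
    unfolding pairing_def by linarith
qed

lemma tendsto_coupling [tendsto_intros]:
  "(f \<longlongrightarrow> b) F \<Longrightarrow> ((\<lambda>n. coupling (f n)) \<longlongrightarrow> coupling b) F"
  unfolding coupling_def by (intro tendsto_intros)

text \<open>
  The parallelogram identity for the quadratic form \<open>coupling\<close>.
\<close>

lemma coupling_midpoint:
  "coupling ((1/2) *\<^sub>R (b + b') - t)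
    = coupling (b - t) / 2 + coupling (b' - t) / 2 - coupling (b - b') / 4"
  by (simp add: coupling_def blinfun.bilinear_simps field_simps)

section \<open>Maximally monotone sets\<close>

lemma monotone_set_iff:
  "monotone_set A \<longleftrightarrow> (\<forall>s\<in>A. \<forall>t\<in>A. 0 \<le> coupling (s - t))"
  by (fastforce simp: monotone_set_def)

lemma maximally_monotone_mem:
  assumes "maximally_monotone_set G" "\<And>t. t \<in> G \<Longrightarrow> 0 \<le> coupling (b - t)"
  shows "b \<in> G"
proof -
  have "monotone_set (insert b G)"
    using assms coupling_diff_commute[of b]
    by (auto simp: maximally_monotone_set_def monotone_set_iff coupling_def)
  then have "insert b G = G"
    using assms(1) unfolding maximally_monotone_set_def by blast
  then show ?thesis by blast
qed

lemma maximally_monotone_nonempty: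
  assumes "maximally_monotone_set G"
  shows "G \<noteq> {}"
  using maximally_monotone_mem[OF assms, of 0] by blast

text \<open>
  If all the values were at least some \<open>e > 0\<close>, then \<open>b\<close> would be monotonically related to \<open>G\<close>, hence a
  member, but \<open>t = b\<close> gives the value \<open>0\<close>. Equivalently, the Fitzpatrick function of \<open>G\<close> dominates the
  coupling.
\<close>

lemma maximally_monotone_inf_le:
  assumes "maximally_monotone_set G" "\<And>t. t \<in> G \<Longrightarrow> e \<le> coupling (b - t)"
  shows "e \<le> 0"
proof (rule ccontr)
  assume "\<not> e \<le> 0"
  then have "b \<in> G"
    using assms by (intro maximally_monotone_mem[of G]) force+
  from assms(2)[OF this] show False
    using \<open>\<not> e \<le> 0\<close> by (simp add: coupling_def)
qed

text \<open>
  If \<open>coupling (b - b')\<close> were very negative, the parallelogram identity would make the midpoint of \<open>b\<close>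
  and \<open>b'\<close> strictly monotonically related to all of \<open>G\<close>, which maximality excludes.
\<close>

lemma almost_members_coupling:
  assumes G: "maximally_monotone_set G"
    and b: "\<And>t. t \<in> G \<Longrightarrow> - e \<le> coupling (b - t)"
    and b': "\<And>t. t \<in> G \<Longrightarrow> - e' \<le> coupling (b' - t)"
  shows "- 2 * (e + e') \<le> coupling (b - b')"
proof -
  have "- e / 2 - e' / 2 - coupling (b - b') / 4 \<le> 0"
  proof (rule maximally_monotone_inf_le[OF G])
    fix t assume "t \<in> G"
    from b[OF this] b'[OF this]
    show "- e / 2 - e' / 2 - coupling (b - b') / 4 \<le> coupling ((1/2) *\<^sub>R (b + b') - t)"
      unfolding coupling_midpoint by linarith
  qed
  then show ?thesis by (simp add: field_simps)
qed

section \<open>Almost members from convex duality\<close>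

text \<open>
  The condition \<open>\<forall>t\<in>G. - e \<le> coupling (b - t)\<close> says that the Fitzpatrick function of \<open>G\<close> exceeds the
  coupling by at most \<open>e\<close> at \<open>b\<close>; for maximally monotone \<open>G\<close> and \<open>e = 0\<close> it is membership in \<open>G\<close>.
  Requiring one bound on the sum of \<open>e\<close> and the density term, instead of two bounds, yields the a priori
  bound on \<open>b - c\<close> in \<open>almost_member_bounded\<close>.
\<close>

definition approximable :: "('a::real_normed_vector \<times> 'a dual) set \<Rightarrow> bool"
  where "approximable G \<longleftrightarrow> (\<forall>c. \<forall>\<epsilon>>0. \<exists>b e. (\<forall>t\<in>G. - e \<le> coupling (b - t)) \<and>
    e + (norm (b - c))\<^sup>2 / 2 + coupling (b - c) \<le> \<epsilon>)"

lemma convex_on_half_norm_power2: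
  "convex_on UNIV (\<lambda>b::'v::real_normed_vector. (norm b)\<^sup>2 / 2 + k)"
  unfolding convex_on_def
proof (intro conjI ballI allI impI convex_UNIV)
  fix x y :: 'v and u v :: real
  assume uv: "0 \<le> u" "0 \<le> v" "u + v = 1"
  have "norm (u *\<^sub>R x + v *\<^sub>R y) \<le> u * norm x + v * norm y"
    using norm_triangle_ineq[of "u *\<^sub>R x" "v *\<^sub>R y"] uv by simp
  then have "(norm (u *\<^sub>R x + v *\<^sub>R y))\<^sup>2 \<le> (u * norm x + v * norm y)\<^sup>2"
    by (intro power_mono) auto
  also have "\<dots> \<le> u * (norm x)\<^sup>2 + v * (norm y)\<^sup>2"
    using convex_power2 uv unfolding convex_on_def by simp
  finally have "(norm (u *\<^sub>R x + v *\<^sub>R y))\<^sup>2 / 2 \<le> u * ((norm x)\<^sup>2 / 2) + v * ((norm y)\<^sup>2 / 2)"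
    by simp
  moreover have "u * k + v * k = k"
    using uv by (simp flip: distrib_right)
  ultimately show "(norm (u *\<^sub>R x + v *\<^sub>R y))\<^sup>2 / 2 + k
      \<le> u * ((norm x)\<^sup>2 / 2 + k) + v * ((norm y)\<^sup>2 / 2 + k)"
    by (simp add: algebra_simps)
qed

text \<open>
  The bound on the unit sphere is uniform, which is what continuity of the separating functional needs.
\<close>

lemma linear_bounded_by_half_norm_power2:
  fixes L :: "'v::real_normed_vector \<Rightarrow> real"
  assumes "linear L" "\<And>w. L w \<le> (norm w)\<^sup>2 / 2 + M"
  shows "bounded_linear L"
proof (rule bounded_linear_intro[where K = "\<bar>1/2 + M\<bar>"])
  interpret L: linear L by fact
  have half: "L x \<le> norm x * \<bar>1/2 + M\<bar>" for x
  proof (cases "x = 0")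
    case False
    have "L ((1 / norm x) *\<^sub>R x) \<le> 1/2 + M"
      using assms(2)[of "(1 / norm x) *\<^sub>R x"] False by simp
    also have "\<dots> \<le> \<bar>1/2 + M\<bar>" by simp
    finally show ?thesis
      using False by (simp add: L.scale field_simps)
  qed (simp add: L.zero)
  show "norm (L x) \<le> norm x * \<bar>1/2 + M\<bar>" for x
    using half[of x] half[of "- x"] by (simp add: L.neg abs_le_iff)
qed (use assms(1) in \<open>auto simp: linear_add linear_scale\<close>)

text \<open>
  Each point of \<open>G\<close> satisfies \<open>coupling (s - t) \<ge> 0\<close>, and after subtracting the quadratic term this is
  an affine inequality, so it passes to convex combinations. It therefore suffices to find
  \<open>(d, \<rho>)\<close> in the convex hull \<open>K\<close> with \<open>\<rho> + \<parallel>d\<parallel>\<^sup>2/2 \<le> \<epsilon>\<close>; then \<open>b = d + c\<close> and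
  \<open>e = \<rho> - coupling d\<close> work. If there were none, the sandwich theorem would give a continuous linear
  \<open>L = (L1, L2)\<close> on \<open>E \<times> E\<^sup>*\<close>, and the bidual inequality would fail at \<open>(x' - L1, x - L2)\<close>, where
  \<open>c = (x, x')\<close>.
\<close>

lemma approximable_of_bidual_inequality:
  assumes G: "monotone_set G" "G \<noteq> {}"
    and bidual: "\<And>(y' :: 'a::real_normed_vector dual) (y'' :: 'a bidual) \<epsilon>. 0 < \<epsilon> \<Longrightarrow>
      \<exists>(s, s') \<in> G. blinfun_apply (s' - y') s - blinfun_apply y'' (s' - y') < \<epsilon>"
  shows "approximable G"
  unfolding approximable_def
proof (intro allI impI)
  fix c :: "'a \<times> 'a dual" and \<epsilon> :: real
  assume \<epsilon>: "0 < \<epsilon>"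
  define K where "K = convex hull ((\<lambda>s. (s - c, coupling (s - c))) ` G)"
  have gen: "(s - c, coupling (s - c)) \<in> K" if "s \<in> G" for s
    unfolding K_def using that by (intro hull_inc) auto
  have "\<exists>d \<rho>. (d, \<rho>) \<in> K \<and> \<rho> + (norm d)\<^sup>2 / 2 \<le> \<epsilon>"
  proof (rule ccontr)
    assume "\<not> ?thesis"
    then have "\<epsilon> < \<rho> + (norm d)\<^sup>2 / 2" if "(d, \<rho>) \<in> K" for d \<rho>
      using that not_le by blast
    then have "0 \<le> ((norm d)\<^sup>2 / 2 + - \<epsilon>) + \<rho>" if "(d, \<rho>) \<in> K" for d \<rho>
      using that by (metis add.commute add.left_commute diff_conv_add_uminus diff_ge_0_iff_ge less_imp_le)
    moreover have "convex K" "K \<noteq> {}"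
      using G(2) gen by (auto simp: K_def)
    ultimately obtain L where L: "linear L"
      "\<And>w b \<rho>. (b, \<rho>) \<in> K \<Longrightarrow> L w - ((norm w)\<^sup>2 / 2 + - \<epsilon>) \<le> L b + \<rho>"
      using affine_sandwich[OF convex_on_half_norm_power2] by metis
    obtain s0 where s0: "s0 \<in> G" using G(2) by blast
    have "bounded_linear L"
    proof (rule linear_bounded_by_half_norm_power2[OF L(1)])
      show "L w \<le> (norm w)\<^sup>2 / 2 + (L (s0 - c) + coupling (s0 - c) - \<epsilon>)" for w
        using L(2)[OF gen[OF s0], of w] by simp
    qed
    define L1 where "L1 = Blinfun (\<lambda>u. L (u, 0))"
    define L2 where "L2 = Blinfun (\<lambda>u'. L (0, u'))"
    have L1: "blinfun_apply L1 u = L (u, 0)" for u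
      unfolding L1_def
      by (subst bounded_linear_Blinfun_apply)
        (auto intro!: bounded_linear_compose[OF \<open>bounded_linear L\<close>] bounded_linear_Pair)
    have L2: "blinfun_apply L2 u' = L (0, u')" for u'
      unfolding L2_def
      by (subst bounded_linear_Blinfun_apply)
        (auto intro!: bounded_linear_compose[OF \<open>bounded_linear L\<close>] bounded_linear_Pair)
    have L_split: "L (u, u') = blinfun_apply L1 u + blinfun_apply L2 u'" for u u'
      using linear_add[OF L(1), of "(u, 0)" "(0, u')"] by (simp add: L1 L2)
    obtain u where u: "norm u \<le> norm L1" "(norm L1)\<^sup>2 - \<epsilon> / 2 \<le> blinfun_apply L1 u"
      using blinfun_almost_norming[of "\<epsilon> / 2" L1] \<epsilon> by auto
    obtain x x' where c: "c = (x, x')" by (cases c)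
    define y' where "y' = x' - L1"
    define J where "J = Blinfun (\<lambda>f::'a dual. blinfun_apply f x)"
    have J: "blinfun_apply J f = blinfun_apply f x" for f
      unfolding J_def
      by (rule bounded_linear_Blinfun_apply[OF blinfun.bounded_linear_left, THEN fun_cong])
    obtain s s' where s: "(s, s') \<in> G"
      and less: "blinfun_apply (s' - y') s - blinfun_apply (J - L2) (s' - y') < \<epsilon> / 2"
      using bidual[of "\<epsilon> / 2" y' "J - L2"] \<epsilon> by auto
    have "blinfun_apply (s' - y') s - blinfun_apply (J - L2) (s' - y')
        = coupling ((s, s') - c) + L ((s, s') - c) + blinfun_apply L2 L1"
      by (simp add: y'_def c J L_split blinfun.bilinear_simps algebra_simps)
    \<comment> \<open>The second component \<open>- L1\<close> is chosen to produce the term \<open>L2 L1\<close> of the identity above, and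
      \<open>u\<close> then compensates for the cost \<open>\<parallel>L1\<parallel>\<^sup>2/2\<close> of it.\<close>
    moreover have "blinfun_apply L1 u - blinfun_apply L2 L1
        - ((norm u)\<^sup>2 + (norm L1)\<^sup>2) / 2 + \<epsilon> \<le> L ((s, s') - c) + coupling ((s, s') - c)"
      using L(2)[OF gen[OF s], of "(u, - L1)"]
      by (simp add: L_split norm_prod_power2 blinfun.minus_right)
    moreover have "(norm u)\<^sup>2 \<le> (norm L1)\<^sup>2"
      using u(1) by (intro power_mono) auto
    ultimately show False
      using less u(2) by (simp add: field_simps)
  qed
  then obtain d \<rho> where d: "(d, \<rho>) \<in> K" "\<rho> + (norm d)\<^sup>2 / 2 \<le> \<epsilon>" by blast
  have "- (\<rho> - coupling d) \<le> coupling (d + c - t)" if "t \<in> G" for t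
  proof -
    define H where "H = {p. 0 \<le> snd p + pairing (fst p) (c - t) + coupling (c - t)}"
    have split: "coupling (b + c - t) = coupling b + pairing b (c - t) + coupling (c - t)" for b
      using coupling_add[of b "c - t"] by (simp add: add_diff_eq)
    have "K \<subseteq> H"
      unfolding K_def
    proof (rule hull_minimal)
      show "(\<lambda>s. (s - c, coupling (s - c))) ` G \<subseteq> H"
      proof (rule image_subsetI)
        fix s assume "s \<in> G"
        then have "0 \<le> coupling (s - t)"
          using G(1) that by (simp add: monotone_set_iff)
        then show "(s - c, coupling (s - c)) \<in> H"
          using split[of "s - c"] by (simp add: H_def)
      qed
      show "convex H"
        unfolding convex_def
      proof (intro ballI allI impI)
        fix p q and u v :: real
        assume pq: "p \<in> H" "q \<in> H" and uv: "0 \<le> u" "0 \<le> v" "u + v = 1"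
        let ?k = "coupling (c - t)"
        have "0 \<le> u * (snd p + pairing (fst p) (c - t) + ?k)
            + v * (snd q + pairing (fst q) (c - t) + ?k)"
          using pq uv by (simp add: H_def)
        also have "\<dots> = snd (u *\<^sub>R p + v *\<^sub>R q) + pairing (fst (u *\<^sub>R p + v *\<^sub>R q)) (c - t)
            + (u + v) * ?k"
          by (simp add: pairing_def blinfun.bilinear_simps algebra_simps)
        finally show "u *\<^sub>R p + v *\<^sub>R q \<in> H"
          using uv by (simp add: H_def)
      qed
    qed
    then have "0 \<le> \<rho> + pairing d (c - t) + coupling (c - t)"
      using d(1) by (auto simp: H_def)
    then show ?thesis
      using split[of d] by simp
  qed
  then show "\<exists>b e. (\<forall>t\<in>G. - e \<le> coupling (b - t)) \<and>
    e + (norm (b - c))\<^sup>2 / 2 + coupling (b - c) \<le> \<epsilon>"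
    using d(2) by (intro exI[of _ "d + c"] exI[of _ "\<rho> - coupling d"]) auto
qed

section \<open>From almost members to members\<close>

lemma half_norm_coupling_nonneg: "0 \<le> (norm b)\<^sup>2 / 2 + coupling b"
  using abs_coupling_le[of b] by linarith

lemma approximableE:
  assumes G: "maximally_monotone_set G" "approximable G" and "0 < \<epsilon>"
  obtains b e where "0 \<le> e" "e \<le> \<epsilon>" "\<And>t. t \<in> G \<Longrightarrow> - e \<le> coupling (b - t)"
    "e + (norm (b - c))\<^sup>2 / 2 + coupling (b - c) \<le> \<epsilon>"
proof -
  obtain b e where b: "\<And>t. t \<in> G \<Longrightarrow> - e \<le> coupling (b - t)"
    "e + (norm (b - c))\<^sup>2 / 2 + coupling (b - c) \<le> \<epsilon>"
    using G(2) \<open>0 < \<epsilon>\<close> unfolding approximable_def by blast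
  have "0 \<le> e"
    using maximally_monotone_inf_le[OF G(1), of "- e" b] b(1) by simp
  moreover have "e \<le> \<epsilon>"
    using b(2) half_norm_coupling_nonneg[of "b - c"] by linarith
  ultimately show ?thesis using that b by blast
qed

text \<open>
  The new point satisfies \<open>\<parallel>b' - b\<parallel>\<^sup>2/2 + coupling (b' - b) \<le> \<delta>\<^sup>2/4\<close>, and its coupling term is bounded
  below since both points are almost members, so the norm itself is of order \<open>\<delta>\<close>.
\<close>

lemma almost_member_step:
  assumes G: "maximally_monotone_set G" "approximable G" and \<delta>: "0 < \<delta>"
    and b: "\<And>t. t \<in> G \<Longrightarrow> - \<delta>\<^sup>2 \<le> coupling (b - t)"
  obtains b' where "\<And>t. t \<in> G \<Longrightarrow> - (\<delta> / 2)\<^sup>2 \<le> coupling (b' - t)" "norm (b' - b) \<le> 3 * \<delta>"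
proof -
  obtain b' e where b': "0 \<le> e" "e \<le> (\<delta> / 2)\<^sup>2" "\<And>t. t \<in> G \<Longrightarrow> - e \<le> coupling (b' - t)"
    "e + (norm (b' - b))\<^sup>2 / 2 + coupling (b' - b) \<le> (\<delta> / 2)\<^sup>2"
    using approximableE[OF G, of "(\<delta> / 2)\<^sup>2" b] \<delta>
    by (metis half_gt_zero zero_less_power)
  have "- 2 * (e + \<delta>\<^sup>2) \<le> coupling (b' - b)"
    using almost_members_coupling[OF G(1) b'(3) b] .
  then have "(norm (b' - b))\<^sup>2 \<le> 9 * \<delta>\<^sup>2"
    using b'(1,2,4) zero_le_power2[of \<delta>] by (simp add: power_divide)
  then have "(norm (b' - b))\<^sup>2 \<le> (3 * \<delta>)\<^sup>2"
    by (simp add: power_mult_distrib)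
  then have "norm (b' - b) \<le> 3 * \<delta>"
    by (rule power2_le_imp_le) (use \<delta> in simp)
  moreover have "- (\<delta> / 2)\<^sup>2 \<le> coupling (b' - t)" if "t \<in> G" for t
    using b'(2) b'(3)[OF that] by linarith
  ultimately show ?thesis using that by blast
qed

text \<open>
  Halving \<open>\<delta>\<close> in every step gives a sequence whose increments sum to at most \<open>6 \<delta>\<close>. Its limit is
  monotonically related to \<open>G\<close> by continuity of the coupling.
\<close>

lemma almost_member_near_member:
  fixes G :: "('a::banach \<times> 'a dual) set"
  assumes G: "maximally_monotone_set G" "approximable G" and \<delta>: "0 < \<delta>"
    and b: "\<And>t. t \<in> G \<Longrightarrow> - \<delta>\<^sup>2 \<le> coupling (b - t)"
  obtains g where "g \<in> G" "norm (g - b) \<le> 6 * \<delta>"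
proof -
  let ?P = "\<lambda>n x. (n = 0 \<longrightarrow> x = b) \<and> (\<forall>t\<in>G. - (\<delta> / 2 ^ n)\<^sup>2 \<le> coupling (x - t))"
  let ?Q = "\<lambda>n x y. norm (y - x) \<le> 3 * (\<delta> / 2 ^ n)"
  have "\<exists>f. \<forall>n. ?P n (f n) \<and> ?Q n (f n) (f (Suc n))"
  proof (rule dependent_nat_choice)
    show "\<exists>x. ?P 0 x" using b by auto
  next
    fix x n assume x: "?P n x"
    obtain y where "\<And>t. t \<in> G \<Longrightarrow> - (\<delta> / 2 ^ n / 2)\<^sup>2 \<le> coupling (y - t)"
      "norm (y - x) \<le> 3 * (\<delta> / 2 ^ n)"
      using almost_member_step[OF G, of "\<delta> / 2 ^ n" x] \<delta> x by auto
    then show "\<exists>y. ?P (Suc n) y \<and> ?Q n x y"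
      by (intro exI[of _ y]) (auto simp: field_simps)
  qed
  then obtain f where f0: "f 0 = b"
    and f: "\<And>n t. t \<in> G \<Longrightarrow> - (\<delta> / 2 ^ n)\<^sup>2 \<le> coupling (f n - t)"
    and step: "\<And>n. norm (f (Suc n) - f n) \<le> 3 * (\<delta> / 2 ^ n)"
    by blast
  have geo: "(\<lambda>n. 3 * (\<delta> / 2 ^ n)) sums (6 * \<delta>)"
    using sums_mult[OF geometric_sums[of "1/2::real"], of "3 * \<delta>"] by (simp add: power_divide)
  define d where "d = (\<Sum>n. f (Suc n) - f n)"
  have "summable (\<lambda>n. f (Suc n) - f n)"
    using step by (intro summable_comparison_test'[OF sums_summable[OF geo]])
  then have "(\<lambda>n. \<Sum>i<n. f (Suc i) - f i) \<longlonglongrightarrow> d"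
    unfolding d_def by (rule summable_LIMSEQ)
  then have "(\<lambda>n. f n - b) \<longlonglongrightarrow> d"
    by (simp add: sum_lessThan_telescope f0)
  from tendsto_add[OF this tendsto_const[of b]]
  have lim: "f \<longlonglongrightarrow> d + b" by simp
  have "d + b \<in> G"
  proof (rule maximally_monotone_mem[OF G(1)])
    fix t assume t: "t \<in> G"
    have "(\<lambda>n. - (\<delta> * (1/2) ^ n)\<^sup>2) \<longlonglongrightarrow> - (\<delta> * 0)\<^sup>2"
      by (intro tendsto_intros LIMSEQ_realpow_zero) auto
    then have "(\<lambda>n. - (\<delta> / 2 ^ n)\<^sup>2) \<longlonglongrightarrow> 0"
      by (simp add: power_divide)
    moreover have "(\<lambda>n. coupling (f n - t)) \<longlonglongrightarrow> coupling (d + b - t)"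
      by (intro tendsto_intros lim)
    ultimately show "0 \<le> coupling (d + b - t)"
      by (rule LIMSEQ_le) (use f[OF t] in auto)
  qed
  moreover have "norm (d + b - b) \<le> 6 * \<delta>"
    using norm_suminf_le[OF step sums_summable[OF geo]] sums_unique[OF geo]
    by (simp add: d_def)
  ultimately show ?thesis by (rule that)
qed

text \<open>
  Comparison with one fixed \<open>t \<in> G\<close> bounds almost members near \<open>c\<close> independently of the error. The bound
  on \<open>\<parallel>\<cdot>\<parallel>\<^sup>2/2 + coupling\<close> alone would not do, since this function may vanish on unbounded sets.
\<close>

lemma almost_member_bounded:
  assumes "- e \<le> coupling (b - t)" "e + (norm (b - c))\<^sup>2 / 2 + coupling (b - c) \<le> 1"
  shows "norm (b - c) \<le> 5 * norm (c - t) + 3"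
proof -
  define N where "N = norm (b - c)"
  define k where "k = norm (c - t)"
  have "coupling (b - t) = coupling (b - c) + coupling (c - t) + pairing (b - c) (c - t)"
    using coupling_add[of "b - c" "c - t"] by simp
  moreover have "\<bar>pairing (b - c) (c - t)\<bar> \<le> 2 * N * k"
    unfolding N_def k_def by (rule pairing_le)
  moreover have "\<bar>coupling (c - t)\<bar> \<le> k\<^sup>2 / 2"
    unfolding k_def by (rule abs_coupling_le)
  ultimately have "N\<^sup>2 / 2 \<le> 1 + 2 * N * k + k\<^sup>2 / 2"
    using assms by (simp add: N_def)
  then have "(N - 2 * k)\<^sup>2 \<le> 2 + 5 * k\<^sup>2"
    by (simp add: power2_eq_square algebra_simps)
  also have "\<dots> \<le> (3 * k + 3)\<^sup>2"
    by (simp add: power2_eq_square algebra_simps k_def)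
  finally have "N - 2 * k \<le> 3 * k + 3"
    by (rule power2_le_imp_le) (simp add: k_def)
  then show ?thesis by (simp add: N_def k_def)
qed

section \<open>Quasidensity\<close>

text \<open>
  Passing from the almost member \<open>b\<close> to the member \<open>g\<close> changes the density term by at most a multiple of
  \<open>\<parallel>b - c\<parallel> \<parallel>g - b\<parallel> + \<parallel>g - b\<parallel>\<^sup>2\<close>, so the bound \<open>R\<close> on \<open>\<parallel>b - c\<parallel>\<close> must be fixed before the error \<open>\<eta>\<^sup>2\<close>.
\<close>

lemma approximable_imp_near:
  fixes G :: "('a::banach \<times> 'a dual) set"
  assumes G: "maximally_monotone_set G" "approximable G" and "0 < \<epsilon>"
  obtains g where "g \<in> G" "(norm (g - c))\<^sup>2 / 2 + coupling (g - c) < \<epsilon>"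
proof -
  obtain t where t: "t \<in> G" using maximally_monotone_nonempty[OF G(1)] by blast
  define R where "R = 5 * norm (c - t) + 3"
  have R: "3 \<le> R" by (simp add: R_def)
  define \<eta> where "\<eta> = min 1 (\<epsilon> / (40 + 20 * R))"
  have \<eta>: "0 < \<eta>" "\<eta> \<le> 1" "\<eta> * (40 + 20 * R) \<le> \<epsilon>"
    using \<open>0 < \<epsilon>\<close> R by (auto simp: \<eta>_def min_def pos_divide_le_eq pos_le_divide_eq)
  have \<eta>2: "\<eta>\<^sup>2 \<le> \<eta>" "0 < \<eta>\<^sup>2" "\<eta>\<^sup>2 \<le> 1"
    using \<eta> power_decreasing[of 1 2 \<eta>] by (auto simp: power_le_one)
  obtain b e where b: "0 \<le> e" "e \<le> \<eta>\<^sup>2" "\<And>t. t \<in> G \<Longrightarrow> - e \<le> coupling (b - t)"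
    "e + (norm (b - c))\<^sup>2 / 2 + coupling (b - c) \<le> \<eta>\<^sup>2"
    using approximableE[OF G \<eta>2(2)] by blast
  have bound: "norm (b - c) \<le> R"
    unfolding R_def
    by (rule almost_member_bounded[OF b(3)[OF t]]) (use b(4) \<eta>2(3) in linarith)
  have "- \<eta>\<^sup>2 \<le> coupling (b - t)" if "t \<in> G" for t
    using b(2) b(3)[OF that] by linarith
  then obtain g where g: "g \<in> G" "norm (g - b) \<le> 6 * \<eta>"
    using almost_member_near_member[OF G \<eta>(1)] by blast
  define m where "m = norm (b - c)"
  define k where "k = norm (g - b)"
  have mk: "0 \<le> m" "m \<le> R" "0 \<le> k" "k \<le> 6 * \<eta>"
    using bound g(2) by (auto simp: m_def k_def)
  have "norm (g - c) \<le> m + k"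
    unfolding m_def k_def using norm_triangle_ineq[of "b - c" "g - b"] by simp
  then have "(norm (g - c))\<^sup>2 \<le> (m + k)\<^sup>2"
    by (intro power_mono) auto
  moreover have "coupling (g - c) = coupling (b - c) + coupling (g - b) + pairing (b - c) (g - b)"
    using coupling_add[of "b - c" "g - b"] by simp
  moreover have "\<bar>coupling (g - b)\<bar> \<le> k\<^sup>2 / 2"
    unfolding k_def by (rule abs_coupling_le)
  moreover have "\<bar>pairing (b - c) (g - b)\<bar> \<le> 2 * m * k"
    unfolding m_def k_def by (rule pairing_le)
  moreover have "m\<^sup>2 / 2 + coupling (b - c) \<le> \<eta>"
    using b(1,4) \<eta>2(1) by (simp add: m_def)
  ultimately have "(norm (g - c))\<^sup>2 / 2 + coupling (g - c) \<le> \<eta> + 3 * (m * k) + k\<^sup>2"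
    unfolding power2_sum by linarith
  also have "m * k \<le> R * (6 * \<eta>)"
    using mk by (intro mult_mono) auto
  also have "k\<^sup>2 \<le> (6 * \<eta>)\<^sup>2"
    using mk by (intro power_mono) auto
  also have "\<eta> + 3 * (R * (6 * \<eta>)) + (6 * \<eta>)\<^sup>2 \<le> \<eta> * (37 + 18 * R)"
    using \<eta>2(1) by (simp add: power_mult_distrib algebra_simps)
  also have "\<dots> < \<eta> * (40 + 20 * R)"
    using \<eta>(1) R by (intro mult_strict_left_mono) auto
  also have "\<dots> \<le> \<epsilon>" by (rule \<eta>(3))
  finally show ?thesis using that g(1) by simp
qed

text \<open>
  Put \<open>w = s' - y' - u\<close> and \<open>R = \<parallel>y''\<parallel>\<close>. Then the quantity to be bounded is
  \<open>w s + u s - y'' w - y'' u\<close>, which by the choice of \<open>u\<close> and density at \<open>(0, y' + u)\<close> is less than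
  \<open>\<epsilon> - (\<parallel>s\<parallel> - R)\<^sup>2/2 - (\<parallel>w\<parallel> - R)\<^sup>2/2\<close>.
\<close>

lemma bidual_inequality_of_dense:
  assumes dense: "\<And>c \<epsilon>. 0 < \<epsilon> \<Longrightarrow>
      \<exists>g\<in>G. (norm (g - c))\<^sup>2 / 2 + coupling (g - c) < \<epsilon>"
    and "0 < \<epsilon>"
  shows "\<exists>(s, s') \<in> G. blinfun_apply (s' - y') s - blinfun_apply y'' (s' - y') < \<epsilon>"
proof -
  obtain u where u: "norm u \<le> norm y''" "(norm y'')\<^sup>2 - \<epsilon> / 2 \<le> blinfun_apply y'' u"
    using blinfun_almost_norming[of "\<epsilon> / 2" y''] \<open>0 < \<epsilon>\<close> by auto
  obtain s s' where s: "(s, s') \<in> G"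
    "(norm ((s, s') - (0, y' + u)))\<^sup>2 / 2 + coupling ((s, s') - (0, y' + u)) < \<epsilon> / 2"
    using dense[of "\<epsilon> / 2" "(0, y' + u)"] \<open>0 < \<epsilon>\<close> by auto
  define R where "R = norm y''"
  define w where "w = s' - (y' + u)"
  have less: "(norm s)\<^sup>2 / 2 + (norm w)\<^sup>2 / 2 + blinfun_apply w s < \<epsilon> / 2"
    using s(2) by (simp add: w_def norm_prod_power2 add_divide_distrib)
  have "blinfun_apply u s \<le> R * norm s"
    using norm_blinfun[of u s] mult_right_mono[OF u(1), of "norm s"] by (simp add: R_def)
  moreover have "- blinfun_apply y'' w \<le> R * norm w"
    using norm_blinfun[of y'' w] by (simp add: R_def)
  moreover have "0 \<le> (norm s - R)\<^sup>2 + (norm w - R)\<^sup>2" by simp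
  then have "R * norm s + R * norm w \<le> R\<^sup>2 + (norm s)\<^sup>2 / 2 + (norm w)\<^sup>2 / 2"
    by (simp add: power2_diff algebra_simps)
  moreover have "s' - y' = w + u" by (simp add: w_def)
  then have "blinfun_apply (s' - y') s - blinfun_apply y'' (s' - y')
      = blinfun_apply w s + blinfun_apply u s - blinfun_apply y'' w - blinfun_apply y'' u"
    by (simp add: blinfun.bilinear_simps)
  ultimately have "blinfun_apply (s' - y') s - blinfun_apply y'' (s' - y') < \<epsilon>"
    using less u(2) by (simp add: R_def)
  then show ?thesis using s(1) by blast
qed

lemma quasidense_iff:
  "quasidense S \<longleftrightarrow>
    (\<forall>c. \<forall>\<epsilon>>0. \<exists>g\<in>graph S. (norm (g - c))\<^sup>2 / 2 + coupling (g - c) < \<epsilon>)"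
proof -
  have "(INF g\<in>graph S. ereal (r g)) \<le> 0 \<longleftrightarrow> (\<forall>\<epsilon>>0. \<exists>g\<in>graph S. r g < \<epsilon>)" for r
    unfolding INF_le_iff
  proof safe
    fix \<epsilon> :: real assume "\<forall>y>0. \<exists>g\<in>graph S. ereal (r g) < y" "0 < \<epsilon>"
    from this(1)[rule_format, of "ereal \<epsilon>"] this(2)
    show "\<exists>g\<in>graph S. r g < \<epsilon>" by simp
  next
    fix y :: ereal assume r: "\<forall>\<epsilon>>0. \<exists>g\<in>graph S. r g < \<epsilon>" and "0 < y"
    then obtain \<epsilon> where "0 < \<epsilon>" "ereal \<epsilon> < y"
      using ereal_dense2[of 0 y] by (auto simp: zero_ereal_def)
    then show "\<exists>g\<in>graph S. ereal (r g) < y"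
      using r by (meson less_ereal.simps(1) less_trans)
  qed
  then have "quasidense S \<longleftrightarrow> (\<forall>x x'. \<forall>\<epsilon>>0. \<exists>g\<in>graph S.
      (norm (fst g - x))\<^sup>2 / 2 + (norm (snd g - x'))\<^sup>2 / 2
        + blinfun_apply (snd g - x') (fst g - x) < \<epsilon>)"
    unfolding quasidense_def case_prod_beta by simp
  then show ?thesis
    by (simp add: norm_prod_power2 coupling_def add_divide_distrib split_paired_All)
qed

lemma pairing_le_theta_iff:
  "ereal (blinfun_apply y'' y') \<le> theta S y' y'' \<longleftrightarrow>
    (\<forall>\<epsilon>>0. \<exists>(s, s') \<in> graph S. blinfun_apply (s' - y') s - blinfun_apply y'' (s' - y') < \<epsilon>)"
proof -
  have "ereal a \<le> (SUP g\<in>graph S. ereal (r g)) \<longleftrightarrow> (\<forall>\<epsilon>>0. \<exists>g\<in>graph S. a - r g < \<epsilon>)" for a r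
    unfolding le_SUP_iff
  proof safe
    fix \<epsilon> :: real assume "\<forall>y<ereal a. \<exists>g\<in>graph S. y < ereal (r g)" "0 < \<epsilon>"
    from this(1)[rule_format, of "ereal (a - \<epsilon>)"] this(2)
    show "\<exists>g\<in>graph S. a - r g < \<epsilon>" by (auto simp: algebra_simps)
  next
    fix y :: ereal assume r: "\<forall>\<epsilon>>0. \<exists>g\<in>graph S. a - r g < \<epsilon>" and "y < ereal a"
    then obtain z where z: "z < a" "y < ereal z"
      using ereal_dense2[of y "ereal a"] by auto
    obtain g where "g \<in> graph S" "a - r g < a - z"
      using r z(1) by (meson diff_gt_0_iff_gt)
    then show "\<exists>g\<in>graph S. y < ereal (r g)"
      using z(2) by (intro bexI[of _ g]) (auto intro: less_trans)
  qed
  from this[of "blinfun_apply y'' y'" "\<lambda>(s, s'). blinfun_apply y' s + blinfun_apply y'' s'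
    - blinfun_apply s' s"] show ?thesis
    unfolding theta_def
    by (simp add: case_prod_beta blinfun.bilinear_simps algebra_simps)
qed

theorem theorem6p12:
  fixes S :: "'a::banach \<Rightarrow> 'a dual set"
  assumes "\<exists>x::'a. x \<noteq> 0"
    and "maximally_monotone S"
  shows "quasidense S \<longleftrightarrow>
    (\<forall>(y' :: 'a dual) (y'' :: 'a bidual). ereal (blinfun_apply y'' y') \<le> theta S y' y'')"
proof
  assume "quasidense S"
  then show "\<forall>(y' :: 'a dual) (y'' :: 'a bidual).
      ereal (blinfun_apply y'' y') \<le> theta S y' y''"
    unfolding quasidense_iff pairing_le_theta_iff
    by (intro allI impI bidual_inequality_of_dense) auto
next
  assume "\<forall>(y' :: 'a dual) (y'' :: 'a bidual). ereal (blinfun_apply y'' y') \<le> theta S y' y''"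
  then have ineq: "\<And>(y' :: 'a dual) (y'' :: 'a bidual) \<epsilon>. 0 < \<epsilon> \<Longrightarrow> \<exists>(s, s') \<in> graph S.
      blinfun_apply (s' - y') s - blinfun_apply y'' (s' - y') < \<epsilon>"
    unfolding pairing_le_theta_iff by blast
  have G: "maximally_monotone_set (graph S)"
    using assms(2) by (simp add: maximally_monotone_def)
  have "approximable (graph S)"
    using G maximally_monotone_nonempty[OF G] ineq
    by (intro approximable_of_bidual_inequality) (auto simp: maximally_monotone_set_def)
  then show "quasidense S"
    unfolding quasidense_iff using approximable_imp_near[OF G] by metis
qed

end
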